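(* Assume that there is a radius $R(h)\to\infty$ and a $\gamma(h)\to0$ (as $h\to0$) such that $$\gamma(h)^{-2}\,\mathbb{E}\sup_{t\in[0,\tau_{R(h),h}]}\|E(t)\|^2\to0\quad\text{for } h\to0 .$$ Moreover, suppose that for a monotone growing function $\varphi:[0,\infty)\to[0,\infty)$ we have, uniformly in $h\in(0,1)$, $$\mathbb{E}\,\varphi\big(\|x(\tau_{R(h),h})\|\big)\le C .$$ Then $$\mathbb{P}\Big(\sup_{t\in[0,T]}\|E(t)\|>\gamma(h)\Big)\to0\quad\text{for } h\to0 .$$
   Context: Fix $T>0$ and dimensions $p,m$. Let $W$ be an $m$-dimensional standard Brownian motion on a filtered probability space. Let $f,f_h:\mathbb{R}^p\to\mathbb{R}^p$ and $g,g_h:\mathbb{R}^p\to\mathbb{R}^{p\times m}$, $h\in(0,1)$, be locally Lipschitz, such that for every $R>0$ there are constants $C_a(R,h),L(R),B(R)$, nondecreasing in $R$, such that for all $u,v$ with norm less than $R$: (1) $\|f_h(u)-f(u)\|\le C_a(R,h)$ and $\|g_h(u)-g(u)\|_{\mathrm{HS}}\le C_a(R,h)$, with $C_a(R,h)\to0$ as $h\to0$; (2) $\|f(u)-f(v)\|\le L(R)\|u-v\|$ and $\|g(u)-g(v)\|_{\mathrm{HS}}\le L(R)\|u-v\|$; (3) $\|f_h(u)\|\le B(R)$ and $\|g_h(u)\|_{\mathrm{HS}}\le B(R)$. Here $\|\cdot\|$ is the Euclidean norm and $\|\cdot\|_{\mathrm{HS}}$ the Hilbert–Schmidt norm. $x$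 is a local solution (i.e. up to a stopping time) of $x(t)=x_0+\int_0^t f(x(s))\,ds+\int_0^t g(x(s))\,dW(s)$. For $h\in(0,1)$ the approximation $Y$ (depending on $h$) is $Y(t)=x_0+\int_0^t f_h(Y(\lfloor s\rfloor))\,ds+\int_0^t g_h(Y(\lfloor s\rfloor))\,dW(s)$, where $\lfloor s\rfloor=\max\{kh\le s: k\in\mathbb{N}_0\}$ denotes rounding down to the grid of step size $h$. The error is $E(t)=x(t)-Y(t)$, so $E(0)=0$. For a radius $R$ the stopping time is $$\tau_{R,h}=T\wedge\inf\{t>0:\ \|x(t)\|>R-1\ \text{or}\ \|E(t)\|>1\}.$$
   Formalization: "Monotone growing" is taken to include φ(r)→∞ (for bounded φ the claim fails: f(u)=u², g=0 explodes before T); γ(h)>0 is assumed, and x is assumed to be defined up to and including τ_{R(h),h} almost surely. *)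

theory Defs
  imports "HOL-Probability.Probability"
begin

section \<open>Filtered probability spaces and Brownian motion\<close>

text \<open>Time is real; only indices \<open>t \<ge> 0\<close> of a filtration or of a process carry meaning.\<close>

definition filtered_prob_space :: "'a measure \<Rightarrow> (real \<Rightarrow> 'a measure) \<Rightarrow> bool" where
  "filtered_prob_space M F \<longleftrightarrow>
     prob_space M \<and> filtration (space M) F \<and> (\<forall>t. subalgebra M (F t))"

definition brownian_motion ::
    "'a measure \<Rightarrow> (real \<Rightarrow> 'a measure) \<Rightarrow> (real \<Rightarrow> 'a \<Rightarrow> real^'m) \<Rightarrow> bool" where
  "brownian_motion M F W \<longleftrightarrow>
     (\<forall>t\<ge>0. W t \<in> borel_measurable (F t)) \<and>
     (\<forall>\<omega>\<in>space M. continuous_on {0..} (\<lambda>t. W t \<omega>)) \<and>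
     (AE \<omega> in M. W 0 \<omega> = 0) \<and>
     (\<forall>s t. 0 \<le> s \<and> s < t \<longrightarrow>
        prob_space.indep_set M (sets (F s))
          {(\<lambda>\<omega>. W t \<omega> - W s \<omega>) -` A \<inter> space M | A. A \<in> sets borel} \<and>
        distributed M lborel (\<lambda>\<omega>. W t \<omega> - W s \<omega>)
          (\<lambda>z. ennreal (\<Prod>i\<in>UNIV. normal_density 0 (sqrt (t - s)) (z $ i))))"

section \<open>The Ito integral\<close>

text \<open>
  A simple integrand is \<open>\<Sum>i<k. \<xi> i * indicator {s i<..s (Suc i)}\<close> with \<open>\<xi> i\<close> bounded and
  \<open>F (s i)\<close>-measurable. Matrices in \<open>real^'m^'p\<close> have \<open>CARD('p)\<close> rows and \<open>CARD('m)\<close> columns,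
  and \<open>norm\<close> on this type is the Hilbert--Schmidt norm.
\<close>

definition simple_integrand ::
    "'a measure \<Rightarrow> (real \<Rightarrow> 'a measure) \<Rightarrow> nat \<Rightarrow> (nat \<Rightarrow> real) \<Rightarrow> (nat \<Rightarrow> 'a \<Rightarrow> real^'m^'p) \<Rightarrow> bool" where
  "simple_integrand M F k s \<xi> \<longleftrightarrow>
     0 \<le> s 0 \<and> mono s \<and>
     (\<forall>i<k. \<xi> i \<in> borel_measurable (F (s i)) \<and> bounded (\<xi> i ` space M))"

definition simple_process ::
    "nat \<Rightarrow> (nat \<Rightarrow> real) \<Rightarrow> (nat \<Rightarrow> 'a \<Rightarrow> real^'m^'p) \<Rightarrow> real \<Rightarrow> 'a \<Rightarrow> real^'m^'p" where
  "simple_process k s \<xi> t \<omega> = (\<Sum>i<k. if s i < t \<and> t \<le> s (Suc i) then \<xi> i \<omega> else 0)"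

definition simple_integral ::
    "(real \<Rightarrow> 'a \<Rightarrow> real^'m) \<Rightarrow> nat \<Rightarrow> (nat \<Rightarrow> real) \<Rightarrow> (nat \<Rightarrow> 'a \<Rightarrow> real^'m^'p) \<Rightarrow>
     real \<Rightarrow> 'a \<Rightarrow> real^'p" where
  "simple_integral W k s \<xi> t \<omega> =
     (\<Sum>i<k. \<xi> i \<omega> *v (W (min (s (Suc i)) t) \<omega> - W (min (s i) t) \<omega>))"

definition progressively_measurable ::
    "(real \<Rightarrow> 'a measure) \<Rightarrow> real \<Rightarrow> (real \<Rightarrow> 'a \<Rightarrow> 'b::topological_space) \<Rightarrow> bool" where
  "progressively_measurable F T H \<longleftrightarrow>
     (\<forall>t\<in>{0..T}. (\<lambda>(s, \<omega>). H s \<omega>) \<in> borel_measurable (restrict_space borel {0..t} \<Otimes>\<^sub>M F t))"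

definition vanishes_in_probability :: "'a measure \<Rightarrow> (nat \<Rightarrow> 'a \<Rightarrow> ennreal) \<Rightarrow> bool" where
  "vanishes_in_probability M X \<longleftrightarrow>
     (\<forall>n. X n \<in> borel_measurable M) \<and>
     (\<forall>\<epsilon>>0. (\<lambda>n. measure M {\<omega>\<in>space M. X n \<omega> > ennreal \<epsilon>}) \<longlonglongrightarrow> 0)"

text \<open>
  \<open>I\<close> is a continuous version of the stochastic integral of \<open>H\<close> against \<open>W\<close> over \<open>[0,T]\<close>, for
  \<open>H\<close> progressively measurable with almost surely square integrable paths: the limit, uniformly
  on \<open>[0,T]\<close> in probability, of the integrals of simple integrands that approximate \<open>H\<close> in the
  sense of \<open>L\<^sup>2[0,T]\<close> in probability. This determines \<open>I\<close> on \<open>[0,T]\<close> up to indistinguishability.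
\<close>

definition has_ito_integral ::
    "'a measure \<Rightarrow> (real \<Rightarrow> 'a measure) \<Rightarrow> (real \<Rightarrow> 'a \<Rightarrow> real^'m) \<Rightarrow> real \<Rightarrow>
     (real \<Rightarrow> 'a \<Rightarrow> real^'m^'p) \<Rightarrow> (real \<Rightarrow> 'a \<Rightarrow> real^'p) \<Rightarrow> bool" where
  "has_ito_integral M F W T H I \<longleftrightarrow>
     progressively_measurable F T H \<and>
     (AE \<omega> in M. (\<integral>\<^sup>+t\<in>{0..T}. ennreal ((norm (H t \<omega>))\<^sup>2) \<partial>lborel) < \<infinity>) \<and>
     (\<forall>t\<in>{0..T}. I t \<in> borel_measurable M) \<and>
     (\<forall>\<omega>\<in>space M. continuous_on {0..T} (\<lambda>t. I t \<omega>)) \<and>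
     (\<exists>k s \<xi>.
        (\<forall>n. simple_integrand M F (k n) (s n) (\<xi> n)) \<and>
        vanishes_in_probability M
          (\<lambda>n \<omega>. \<integral>\<^sup>+t\<in>{0..T}. ennreal ((norm (simple_process (k n) (s n) (\<xi> n) t \<omega> - H t \<omega>))\<^sup>2) \<partial>lborel) \<and>
        vanishes_in_probability M
          (\<lambda>n \<omega>. SUP t\<in>{0..T}. ennreal (norm (simple_integral W (k n) (s n) (\<xi> n) t \<omega> - I t \<omega>))))"

section \<open>The equation, its approximation and the error\<close>

text \<open>
  \<open>x\<close> solves \<open>dx = f(x) dt + g(x) dW\<close>, \<open>x(0) = x0\<close> on the part of \<open>[0,\<sigma>)\<close> that lies in \<open>[0,T]\<close>.
  Values of \<open>x\<close> at or after \<open>\<sigma>\<close> are irrelevant. Capping \<open>\<sigma>\<close> at a value beyond \<open>T\<close> changes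
  nothing, so a real-valued \<open>\<sigma>\<close> suffices; \<open>\<sigma> > T\<close> means that \<open>x\<close> lives on all of \<open>[0,T]\<close>.
  The stopping times \<open>\<rho> n\<close> localise the integrand, so that its square is integrable.
\<close>

definition local_solution ::
    "'a measure \<Rightarrow> (real \<Rightarrow> 'a measure) \<Rightarrow> (real \<Rightarrow> 'a \<Rightarrow> real^'m) \<Rightarrow> real \<Rightarrow>
     (real^'p \<Rightarrow> real^'p) \<Rightarrow> (real^'p \<Rightarrow> real^'m^'p) \<Rightarrow> ('a \<Rightarrow> real^'p) \<Rightarrow>
     ('a \<Rightarrow> real) \<Rightarrow> (real \<Rightarrow> 'a \<Rightarrow> real^'p) \<Rightarrow> bool" where
  "local_solution M F W T f g x0 \<sigma> x \<longleftrightarrow>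
     stopping_time F \<sigma> \<and> (\<forall>\<omega>\<in>space M. 0 < \<sigma> \<omega>) \<and>
     (\<forall>t\<in>{0..T}. (\<lambda>\<omega>. if t < \<sigma> \<omega> then x t \<omega> else 0) \<in> borel_measurable (F t)) \<and>
     (\<forall>\<omega>\<in>space M. continuous_on {t\<in>{0..T}. t < \<sigma> \<omega>} (\<lambda>t. x t \<omega>)) \<and>
     (\<exists>\<rho> :: nat \<Rightarrow> 'a \<Rightarrow> real.
        (\<forall>n. stopping_time F (\<rho> n)) \<and>
        (\<forall>\<omega>\<in>space M. incseq (\<lambda>n. \<rho> n \<omega>) \<and> (\<forall>n. \<rho> n \<omega> \<le> \<sigma> \<omega>)) \<and>
        (AE \<omega> in M. (\<lambda>n. \<rho> n \<omega>) \<longlonglongrightarrow> \<sigma> \<omega>) \<and>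
        (\<forall>n. \<exists>I. has_ito_integral M F W T (\<lambda>s \<omega>. if s < \<rho> n \<omega> then g (x s \<omega>) else 0) I \<and>
           (AE \<omega> in M. \<forall>t\<in>{0..T}. t < \<rho> n \<omega> \<longrightarrow>
              x t \<omega> = x0 \<omega> + (LINT s:{0..t}|lborel. f (x s \<omega>)) + I t \<omega>)))"

definition grid_floor :: "real \<Rightarrow> real \<Rightarrow> real" where
  "grid_floor h s = Max {real k * h | k :: nat. real k * h \<le> s}"

definition grid_approximation ::
    "'a measure \<Rightarrow> (real \<Rightarrow> 'a measure) \<Rightarrow> (real \<Rightarrow> 'a \<Rightarrow> real^'m) \<Rightarrow> real \<Rightarrow>
     (real^'p \<Rightarrow> real^'p) \<Rightarrow> (real^'p \<Rightarrow> real^'m^'p) \<Rightarrow> ('a \<Rightarrow> real^'p) \<Rightarrow>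
     real \<Rightarrow> (real \<Rightarrow> 'a \<Rightarrow> real^'p) \<Rightarrow> bool" where
  "grid_approximation M F W T fh gh x0 h Y \<longleftrightarrow>
     (\<forall>t\<in>{0..T}. Y t \<in> borel_measurable (F t)) \<and>
     (\<forall>\<omega>\<in>space M. continuous_on {0..T} (\<lambda>t. Y t \<omega>)) \<and>
     (\<exists>I. has_ito_integral M F W T (\<lambda>s \<omega>. gh (Y (grid_floor h s) \<omega>)) I \<and>
        (AE \<omega> in M. \<forall>t\<in>{0..T}.
           Y t \<omega> = x0 \<omega> + (LINT s:{0..t}|lborel. fh (Y (grid_floor h s) \<omega>)) + I t \<omega>))"

definition approx_coefficients ::
    "(real^'p \<Rightarrow> real^'p) \<Rightarrow> (real^'p \<Rightarrow> real^'m^'p) \<Rightarrow>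
     (real \<Rightarrow> real^'p \<Rightarrow> real^'p) \<Rightarrow> (real \<Rightarrow> real^'p \<Rightarrow> real^'m^'p) \<Rightarrow> bool" where
  "approx_coefficients f g fh gh \<longleftrightarrow>
     local_lipschitz (UNIV :: real set) UNIV (\<lambda>_. f) \<and>
     local_lipschitz (UNIV :: real set) UNIV (\<lambda>_. g) \<and>
     (\<forall>h\<in>{0<..<1}. local_lipschitz (UNIV :: real set) UNIV (\<lambda>_. fh h) \<and>
                     local_lipschitz (UNIV :: real set) UNIV (\<lambda>_. gh h)) \<and>
     (\<exists>(Ca :: real \<Rightarrow> real \<Rightarrow> real) (L :: real \<Rightarrow> real) (B :: real \<Rightarrow> real).
        (\<forall>h\<in>{0<..<1}. mono_on {0<..} (\<lambda>R. Ca R h)) \<and> mono_on {0<..} L \<and> mono_on {0<..} B \<and>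
        (\<forall>R>0. ((\<lambda>h. Ca R h) \<longlongrightarrow> 0) (at_right 0)) \<and>
        (\<forall>R>0. \<forall>u v. norm u < R \<and> norm v < R \<longrightarrow>
           (\<forall>h\<in>{0<..<1}. norm (fh h u - f u) \<le> Ca R h \<and> norm (gh h u - g u) \<le> Ca R h) \<and>
           norm (f u - f v) \<le> L R * norm (u - v) \<and>
           norm (g u - g v) \<le> L R * norm (u - v) \<and>
           (\<forall>h\<in>{0<..<1}. norm (fh h u) \<le> B R \<and> norm (gh h u) \<le> B R)))"

text \<open>
  \<open>T \<and> inf {t > 0. \<parallel>x(t)\<parallel> > R - 1 or \<parallel>x(t) - Y(t)\<parallel> > 1}\<close>, with \<open>t\<close> ranging over the times where
  \<open>x\<close> is defined. Inserting \<open>T\<close> into the set accounts for the minimum and for \<open>inf {} = \<infinity>\<close>.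
\<close>

definition exit_time ::
    "real \<Rightarrow> ('a \<Rightarrow> real) \<Rightarrow> (real \<Rightarrow> 'a \<Rightarrow> real^'p) \<Rightarrow> (real \<Rightarrow> 'a \<Rightarrow> real^'p) \<Rightarrow> real \<Rightarrow> 'a \<Rightarrow> real" where
  "exit_time T \<sigma> x Y R \<omega> =
     Inf (insert T {t. 0 < t \<and> t \<le> T \<and> t < \<sigma> \<omega> \<and>
                       (norm (x t \<omega>) > R - 1 \<or> norm (x t \<omega> - Y t \<omega>) > 1)})"

end

theory Submission
  imports Defs
begin

text \<open>
  Up to the exit time \<open>\<tau>\<close> the error is controlled by the assumed rate and Markov's inequality.
  If \<open>\<tau> < T\<close>, then by path continuity \<open>\<parallel>E(\<tau>)\<parallel> \<ge> 1 > \<gamma>\<close>, which the rate already excludes with high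
  probability, or \<open>\<parallel>x(\<tau>)\<parallel> \<ge> R - 1\<close>, which has probability at most \<open>C / \<phi>(R - 1) \<longrightarrow> 0\<close>.
\<close>

section \<open>Rational witnesses and a Markov bound\<close>

text \<open>A strict inequality at \<open>s\<close> persists on a relative neighbourhood, and this
  meets the interior of the interval even if \<open>s\<close> is an endpoint. It serves to turn
  existential statements over real times into countable unions.\<close>

lemma continuous_on_Rats_witness:
  fixes u :: "real \<Rightarrow> real"
  assumes cont: "continuous_on {a..b} u" and ab: "a < b"
    and s: "s \<in> {a..b}" and c: "c < u s"
  obtains q where "q \<in> \<rat>" "a < q" "q < b" "c < u q"
proof -
  obtain d where d: "d > 0" "\<And>t. t \<in> {a..b} \<Longrightarrow> dist t s < d \<Longrightarrow> dist (u t) (u s) < u s - c"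
    using cont s c unfolding continuous_on_iff by (meson diff_gt_0_iff_gt)
  obtain q where q: "q \<in> \<rat>" "max a (s - d) < q" "q < min b (s + d)"
    using Rats_dense_in_real[of "max a (s - d)" "min b (s + d)"] ab s d(1) by auto
  have "dist (u q) (u s) < u s - c"
    using q by (intro d(2)) (auto simp: dist_real_def)
  then show thesis
    using q by (intro that[of q]) (auto simp: dist_real_def)
qed

text \<open>
  Measurability is required of \<open>A\<close> only: \<open>u\<close> will be a functional of the paths of \<open>x\<close>, which are
  arbitrary from \<open>\<sigma>\<close> on, so it need not be measurable.
\<close>

lemma nn_integral_Markov_subset:
  assumes "A \<in> sets M" "\<And>\<omega>. \<omega> \<in> A \<Longrightarrow> c \<le> u \<omega>"
  shows "c * emeasure M A \<le> (\<integral>\<^sup>+\<omega>. u \<omega> \<partial>M)"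
proof -
  have "c * emeasure M A = (\<integral>\<^sup>+\<omega>. c * indicator A \<omega> \<partial>M)"
    using assms(1) by (simp add: nn_integral_cmult_indicator)
  also have "\<dots> \<le> (\<integral>\<^sup>+\<omega>. u \<omega> \<partial>M)"
    using assms(2) by (intro nn_integral_mono) (auto simp: indicator_def)
  finally show ?thesis .
qed

section \<open>The exit time along a single path\<close>

lemma exit_time_less_iff:
  assumes "T > 0"
  shows "exit_time T \<sigma> x Y R \<omega> < t \<longleftrightarrow>
    T < t \<or> (\<exists>s. 0 < s \<and> s \<le> T \<and> s < \<sigma> \<omega> \<and> s < t \<and>
                (norm (x s \<omega>) > R - 1 \<or> norm (x s \<omega> - Y s \<omega>) > 1))"
  unfolding exit_time_def using assms
  by (subst cInf_less_iff) (auto intro!: bdd_belowI[of _ 0])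

lemma exit_time_le: "T > 0 \<Longrightarrow> exit_time T \<sigma> x Y R \<omega> \<le> T"
  unfolding exit_time_def by (intro cInf_lower) (auto intro!: bdd_belowI[of _ 0])

lemma exit_time_nonneg: "T > 0 \<Longrightarrow> 0 \<le> exit_time T \<sigma> x Y R \<omega>"
  unfolding exit_time_def by (intro cInf_greatest) auto

text \<open>Moving slightly to the left of a violating time preserves \<open>s \<le> T\<close>,
  \<open>s < \<sigma> \<omega>\<close> and \<open>s < t\<close>, and continuity preserves the strict
  violation. The resulting countable index set is what makes the exit time measurable.\<close>

lemma exit_time_less_Rats_iff:
  assumes T: "T > 0"
    and x: "continuous_on {t\<in>{0..T}. t < \<sigma> \<omega>} (\<lambda>t. x t \<omega>)"
    and Y: "continuous_on {0..T} (\<lambda>t. Y t \<omega>)"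
  shows "exit_time T \<sigma> x Y R \<omega> < t \<longleftrightarrow>
    T < t \<or> (\<exists>s\<in>\<rat>. 0 < s \<and> s \<le> T \<and> s < \<sigma> \<omega> \<and> s < t \<and>
                (norm (x s \<omega>) > R - 1 \<or> norm (x s \<omega> - Y s \<omega>) > 1))"
    (is "_ \<longleftrightarrow> _ \<or> ?Q")
proof -
  have ?Q if s: "0 < s" "s \<le> T" "s < \<sigma> \<omega>" "s < t"
    "norm (x s \<omega>) > R - 1 \<or> norm (x s \<omega> - Y s \<omega>) > 1" for s
  proof -
    \<comment> \<open>The left end \<open>s / 2\<close> keeps the rational witness strictly
      positive.\<close>
    have x': "continuous_on {s / 2..s} (\<lambda>t. x t \<omega>)"
      and Y': "continuous_on {s / 2..s} (\<lambda>t. Y t \<omega>)"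
      by (rule continuous_on_subset[OF x] continuous_on_subset[OF Y]; use s in auto)+
    have X: "continuous_on {s / 2..s} (\<lambda>t. norm (x t \<omega>))"
      and E: "continuous_on {s / 2..s} (\<lambda>t. norm (x t \<omega> - Y t \<omega>))"
      by (intro continuous_intros x' Y')+
    from s(5) show ?Q
    proof
      assume "norm (x s \<omega>) > R - 1"
      with continuous_on_Rats_witness[OF X, of s "R - 1"] s
      obtain q where "q \<in> \<rat>" "s / 2 < q" "q < s" "R - 1 < norm (x q \<omega>)" by auto
      then show ?Q using s by (intro bexI[of _ q]) auto
    next
      assume "norm (x s \<omega> - Y s \<omega>) > 1"
      with continuous_on_Rats_witness[OF E, of s 1] s
      obtain q where "q \<in> \<rat>" "s / 2 < q" "q < s" "1 < norm (x q \<omega> - Y q \<omega>)" by auto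
      then show ?Q using s by (intro bexI[of _ q]) auto
    qed
  qed
  then show ?thesis
    unfolding exit_time_less_iff[OF T] by blast
qed

text \<open>If both norms were strictly below their thresholds at \<open>\<tau>\<close>, continuity
  would keep them there for a while after \<open>\<tau>\<close>, whereas the infimum calls for
  violating times arbitrarily close to \<open>\<tau>\<close>. Passing to the limit turns strict
  thresholds into weak ones.\<close>

lemma exit_time_early:
  assumes T: "T > 0"
    and x: "continuous_on {t\<in>{0..T}. t < \<sigma> \<omega>} (\<lambda>t. x t \<omega>)"
    and Y: "continuous_on {0..T} (\<lambda>t. Y t \<omega>)"
    and \<tau>: "\<tau> = exit_time T \<sigma> x Y R \<omega>" "\<tau> < T" "\<tau> < \<sigma> \<omega>"
  shows "R - 1 \<le> norm (x \<tau> \<omega>) \<or> 1 \<le> norm (x \<tau> \<omega> - Y \<tau> \<omega>)"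
proof (rule ccontr)
  assume "\<not> ?thesis"
  then have less: "norm (x \<tau> \<omega>) < R - 1" "norm (x \<tau> \<omega> - Y \<tau> \<omega>) < 1" by auto
  let ?D = "{t\<in>{0..T}. t < \<sigma> \<omega>}"
  have \<tau>D: "\<tau> \<in> ?D"
    using \<tau> exit_time_nonneg[OF T, of \<sigma> x Y R \<omega>] by auto
  have Y': "continuous_on ?D (\<lambda>t. Y t \<omega>)"
    by (rule continuous_on_subset[OF Y]) auto
  have X: "continuous_on ?D (\<lambda>t. norm (x t \<omega>))"
    and E: "continuous_on ?D (\<lambda>t. norm (x t \<omega> - Y t \<omega>))"
    by (intro continuous_intros x Y')+
  obtain d where d: "d > 0"
    "\<And>t. t \<in> ?D \<Longrightarrow> dist t \<tau> < d \<Longrightarrow> dist (norm (x t \<omega>)) (norm (x \<tau> \<omega>)) < R - 1 - norm (x \<tau> \<omega>)"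
    using X \<tau>D less(1) unfolding continuous_on_iff by (meson diff_gt_0_iff_gt)
  obtain e where e: "e > 0"
    "\<And>t. t \<in> ?D \<Longrightarrow> dist t \<tau> < e \<Longrightarrow>
      dist (norm (x t \<omega> - Y t \<omega>)) (norm (x \<tau> \<omega> - Y \<tau> \<omega>)) < 1 - norm (x \<tau> \<omega> - Y \<tau> \<omega>)"
    using E \<tau>D less(2) unfolding continuous_on_iff by (meson diff_gt_0_iff_gt)
  \<comment> \<open>The cap \<open>T\<close> rules out the first alternative of
    \<open>exit_time_less_iff\<close>, so a genuine violating time remains; \<open>d\<close> and
    \<open>e\<close> place it in both neighbourhoods of \<open>\<tau>\<close>.\<close>
  have "exit_time T \<sigma> x Y R \<omega> < min T (\<tau> + min d e)"
    using \<tau> d(1) e(1) by auto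
  then obtain s where s: "0 < s" "s \<le> T" "s < \<sigma> \<omega>" "s < \<tau> + min d e"
    "norm (x s \<omega>) > R - 1 \<or> norm (x s \<omega> - Y s \<omega>) > 1"
    unfolding exit_time_less_iff[OF T] by auto
  have "\<tau> \<le> s"
    unfolding \<tau>(1) exit_time_def using T s
    by (intro cInf_lower) (auto intro!: bdd_belowI[of _ 0])
  then have "s \<in> ?D" "dist s \<tau> < d" "dist s \<tau> < e"
    using s by (auto simp: dist_real_def)
  from d(2)[OF this(1,2)] e(2)[OF this(1,3)] s(5) show False
    by (auto simp: dist_real_def)
qed

section \<open>Measurability of the exit time and of the error event\<close>

context
  fixes M :: "'a measure" and T R :: real and \<sigma> :: "'a \<Rightarrow> real"
    and x Y :: "real \<Rightarrow> 'a \<Rightarrow> real^'p"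
  assumes T: "T > 0"
    and \<sigma>: "\<sigma> \<in> borel_measurable M"
    and x_meas: "\<And>t. t \<in> {0..T} \<Longrightarrow> (\<lambda>\<omega>. if t < \<sigma> \<omega> then x t \<omega> else 0) \<in> borel_measurable M"
    and x_cont: "\<And>\<omega>. \<omega> \<in> space M \<Longrightarrow> continuous_on {t\<in>{0..T}. t < \<sigma> \<omega>} (\<lambda>t. x t \<omega>)"
    and Y_meas: "\<And>t. t \<in> {0..T} \<Longrightarrow> Y t \<in> borel_measurable M"
    and Y_cont: "\<And>\<omega>. \<omega> \<in> space M \<Longrightarrow> continuous_on {0..T} (\<lambda>t. Y t \<omega>)"
begin

text \<open>Measurability is given only for \<open>x t\<close> set to 0 from \<open>\<sigma>\<close>
  on; the conjunct \<open>t < \<sigma> \<omega>\<close> restricts to outcomes where this truncation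
  agrees with \<open>x t\<close>.\<close>

lemma norm_before_measurable:
  assumes "t \<in> {0..T}"
  shows "{\<omega>\<in>space M. t < \<sigma> \<omega> \<and> c < norm (x t \<omega>)} \<in> sets M"
proof -
  note [measurable] = \<sigma> x_meas[OF assms]
  have "{\<omega>\<in>space M. t < \<sigma> \<omega> \<and> c < norm (if t < \<sigma> \<omega> then x t \<omega> else 0)} \<in> sets M"
    by measurable
  then show ?thesis
    by (rule back_subst[of "\<lambda>A. A \<in> sets M"]) auto
qed

lemma norm_diff_before_measurable:
  assumes "t \<in> {0..T}"
  shows "{\<omega>\<in>space M. t < \<sigma> \<omega> \<and> c < norm (x t \<omega> - Y t \<omega>)} \<in> sets M"
proof -
  note [measurable] = \<sigma> x_meas[OF assms] Y_meas[OF assms]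
  have "{\<omega>\<in>space M. t < \<sigma> \<omega> \<and> c < norm ((if t < \<sigma> \<omega> then x t \<omega> else 0) - Y t \<omega>)} \<in> sets M"
    by measurable
  then show ?thesis
    by (rule back_subst[of "\<lambda>A. A \<in> sets M"]) auto
qed

lemma exit_time_measurable: "exit_time T \<sigma> x Y R \<in> borel_measurable M"
proof (rule borel_measurable_iff_less[THEN iffD2], rule)
  fix t
  let ?A = "\<lambda>s. {\<omega>\<in>space M. s < \<sigma> \<omega> \<and> R - 1 < norm (x s \<omega>)} \<union>
                  {\<omega>\<in>space M. s < \<sigma> \<omega> \<and> 1 < norm (x s \<omega> - Y s \<omega>)}"
  \<comment> \<open>For \<open>T < t\<close> the event is the whole space, because the exit time
    never exceeds \<open>T\<close>.\<close>
  have "{\<omega>\<in>space M. exit_time T \<sigma> x Y R \<omega> < t} =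
    (if T < t then space M else (\<Union>s\<in>{s\<in>\<rat>. 0 < s \<and> s \<le> T \<and> s < t}. ?A s))"
    using exit_time_less_Rats_iff[where x = x and Y = Y and \<sigma> = \<sigma> and R = R and t = t, OF T x_cont Y_cont]
    by auto
  also have "\<dots> \<in> sets M"
    using countable_rat
    by (auto intro!: sets.countable_UN' sets.Un norm_before_measurable norm_diff_before_measurable
        intro: countable_subset)
  finally show "{\<omega>\<in>space M. exit_time T \<sigma> x Y R \<omega> < t} \<in> sets M" .
qed

text \<open>On \<open>exit_time T \<sigma> x Y R \<omega> < \<sigma> \<omega>\<close> every time up
  to the exit lies before \<open>\<sigma>\<close>, so the error path is continuous there and
  rational times detect an excess over \<open>c\<close>. This supplies the measurable set needed for
  the Markov bound.\<close>

lemma error_before_exit_measurable: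
  assumes \<sigma>_pos: "\<And>\<omega>. \<omega> \<in> space M \<Longrightarrow> 0 < \<sigma> \<omega>"
  shows "{\<omega>\<in>space M. exit_time T \<sigma> x Y R \<omega> < \<sigma> \<omega> \<and>
           (\<exists>t\<in>{0..exit_time T \<sigma> x Y R \<omega>}. c < norm (x t \<omega> - Y t \<omega>))} \<in> sets M"
proof -
  note [measurable] = \<sigma> exit_time_measurable
  let ?\<tau> = "exit_time T \<sigma> x Y R"
  let ?E = "\<lambda>s. {\<omega>\<in>space M. s < \<sigma> \<omega> \<and> c < norm (x s \<omega> - Y s \<omega>)}"
  \<comment> \<open>Time 0 gets its own event: the exit time may be 0, and then there is no
    nondegenerate interval from which to draw a rational witness.\<close>
  let ?S = "{\<omega>\<in>space M. ?\<tau> \<omega> < \<sigma> \<omega>} \<inter>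
    (?E 0 \<union> (\<Union>s\<in>{s\<in>\<rat>. 0 < s \<and> s < T}. {\<omega>\<in>space M. s < ?\<tau> \<omega>} \<inter> ?E s))"
  have rat: "\<exists>s\<in>{s\<in>\<rat>. 0 < s \<and> s < T}. s < ?\<tau> \<omega> \<and> s < \<sigma> \<omega> \<and> c < norm (x s \<omega> - Y s \<omega>)"
    if \<omega>: "\<omega> \<in> space M" "?\<tau> \<omega> < \<sigma> \<omega>" and t: "t \<in> {0..?\<tau> \<omega>}" "c < norm (x t \<omega> - Y t \<omega>)" "t \<noteq> 0"
    for \<omega> t
  proof -
    have le: "?\<tau> \<omega> \<le> T" by (rule exit_time_le[OF T])
    have "continuous_on {0..?\<tau> \<omega>} (\<lambda>t. norm (x t \<omega> - Y t \<omega>))"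
      using \<omega> le
      by (intro continuous_intros continuous_on_subset[OF x_cont] continuous_on_subset[OF Y_cont]) auto
    then obtain q where "q \<in> \<rat>" "0 < q" "q < ?\<tau> \<omega>" "c < norm (x q \<omega> - Y q \<omega>)"
      by (rule continuous_on_Rats_witness) (use t in auto)
    then show ?thesis
      using \<omega> le by (intro bexI[of _ q]) auto
  qed
  have "{\<omega>\<in>space M. ?\<tau> \<omega> < \<sigma> \<omega> \<and> (\<exists>t\<in>{0..?\<tau> \<omega>}. c < norm (x t \<omega> - Y t \<omega>))} = ?S"
  proof (intro subset_antisym subsetI)
    fix \<omega> assume "\<omega> \<in> {\<omega>\<in>space M. ?\<tau> \<omega> < \<sigma> \<omega> \<and> (\<exists>t\<in>{0..?\<tau> \<omega>}. c < norm (x t \<omega> - Y t \<omega>))}"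
    then obtain t where t: "\<omega> \<in> space M" "?\<tau> \<omega> < \<sigma> \<omega>" "t \<in> {0..?\<tau> \<omega>}" "c < norm (x t \<omega> - Y t \<omega>)"
      by auto
    then show "\<omega> \<in> ?S"
      using rat[OF t] \<sigma>_pos[OF t(1)] by (cases "t = 0") auto
  next
    fix \<omega> assume "\<omega> \<in> ?S"
    then show "\<omega> \<in> {\<omega>\<in>space M. ?\<tau> \<omega> < \<sigma> \<omega> \<and> (\<exists>t\<in>{0..?\<tau> \<omega>}. c < norm (x t \<omega> - Y t \<omega>))}"
      using exit_time_nonneg[OF T, of \<sigma> x Y R \<omega>] by force
  qed
  also have "?S \<in> sets M"
    using countable_rat T
    by (intro sets.Int sets.Un sets.countable_UN' norm_diff_before_measurable)
      (auto intro: countable_subset intro!: sets.Int norm_diff_before_measurable)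
  finally show ?thesis .
qed

section \<open>Probability bound for a fixed step size\<close>

text \<open>Here \<open>c\<close> stands for the value of \<open>\<gamma>\<close> at one step size.
  Outcomes with \<open>\<sigma> \<omega> \<le> T\<close> count as failures, since \<open>x\<close>
  then does not live on all of \<open>[0,T]\<close>.\<close>

lemma emeasure_error_le:
  assumes \<sigma>_pos: "\<And>\<omega>. \<omega> \<in> space M \<Longrightarrow> 0 < \<sigma> \<omega>"
    and defined: "AE \<omega> in M. exit_time T \<sigma> x Y R \<omega> < \<sigma> \<omega>"
    and c: "0 < c" "c < 1" and R: "1 \<le> R"
    and \<phi>: "mono_on {0..} \<phi>" "\<phi> (R - 1) > 0"
    and moment: "(\<integral>\<^sup>+\<omega>. ennreal (\<phi> (norm (x (exit_time T \<sigma> x Y R \<omega>) \<omega>))) \<partial>M) \<le> ennreal C"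
  shows "emeasure M {\<omega>\<in>space M. \<sigma> \<omega> \<le> T \<or> (SUP t\<in>{0..T}. ennreal (norm (x t \<omega> - Y t \<omega>))) > ennreal c}
    \<le> ennreal (1 / c\<^sup>2) * (\<integral>\<^sup>+\<omega>. (SUP t\<in>{0..exit_time T \<sigma> x Y R \<omega>}. ennreal ((norm (x t \<omega> - Y t \<omega>))\<^sup>2)) \<partial>M)
      + ennreal C * ennreal (1 / \<phi> (R - 1))"
    (is "emeasure M ?B \<le> _ * ?I + _")
\<comment> \<open>A set outside \<open>sets M\<close> has \<open>emeasure\<close> 0, which makes the
  bound trivial; the case split replaces a proof that \<open>?B\<close> is measurable.\<close>
proof (cases "?B \<in> sets M")
  case False
  then show ?thesis by (simp add: emeasure_notin_sets)
next
  case B[measurable]: True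
  note [measurable] = \<sigma> exit_time_measurable
  let ?\<tau> = "exit_time T \<sigma> x Y R"
  \<comment> \<open>\<open>G\<close> has full measure and makes the values of \<open>x\<close> up to
    the exit time meaningful. \<open>A\<close> is charged to the error integral, the remainder
    \<open>D\<close> to the moment of \<open>\<phi>\<close>.\<close>
  define G where "G = {\<omega>\<in>space M. ?\<tau> \<omega> < \<sigma> \<omega>}"
  define A where "A = {\<omega>\<in>space M. ?\<tau> \<omega> < \<sigma> \<omega> \<and> (\<exists>t\<in>{0..?\<tau> \<omega>}. c < norm (x t \<omega> - Y t \<omega>))}"
  define D where "D = ?B \<inter> G - A"
  have A[measurable]: "A \<in> sets M"
    unfolding A_def by (rule error_before_exit_measurable[OF \<sigma>_pos])
  have G[measurable]: "G \<in> sets M" unfolding G_def by measurable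
  have D[measurable]: "D \<in> sets M" unfolding D_def by measurable
  have "ennreal (c\<^sup>2) * emeasure M A \<le> ?I"
  proof (rule nn_integral_Markov_subset[OF A])
    fix \<omega> assume "\<omega> \<in> A"
    then obtain t where t: "t \<in> {0..?\<tau> \<omega>}" "c < norm (x t \<omega> - Y t \<omega>)"
      by (auto simp: A_def)
    have "c\<^sup>2 \<le> (norm (x t \<omega> - Y t \<omega>))\<^sup>2"
      using t(2) c(1) by (intro power_mono) auto
    then show "ennreal (c\<^sup>2) \<le> (SUP t\<in>{0..?\<tau> \<omega>}. ennreal ((norm (x t \<omega> - Y t \<omega>))\<^sup>2))"
      by (intro SUP_upper2[OF t(1)] ennreal_leI)
  qed
  then have "ennreal (1 / c\<^sup>2) * (ennreal (c\<^sup>2) * emeasure M A) \<le> ennreal (1 / c\<^sup>2) * ?I"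
    by (rule mult_left_mono) simp
  moreover have "ennreal (1 / c\<^sup>2) * (ennreal (c\<^sup>2) * emeasure M A) = emeasure M A"
    using c(1) by (simp add: mult.assoc[symmetric] ennreal_mult[symmetric])
  ultimately have PA: "emeasure M A \<le> ennreal (1 / c\<^sup>2) * ?I" by simp
  have "ennreal (\<phi> (R - 1)) * emeasure M D \<le> (\<integral>\<^sup>+\<omega>. ennreal (\<phi> (norm (x (?\<tau> \<omega>) \<omega>))) \<partial>M)"
  proof (rule nn_integral_Markov_subset[OF D])
    fix \<omega> assume \<omega>: "\<omega> \<in> D"
    then have sp: "\<omega> \<in> space M" and \<tau>\<sigma>: "?\<tau> \<omega> < \<sigma> \<omega>"
      and small: "\<And>t. t \<in> {0..?\<tau> \<omega>} \<Longrightarrow> norm (x t \<omega> - Y t \<omega>) \<le> c"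
      by (auto simp: D_def G_def A_def not_less)
    \<comment> \<open>Otherwise \<open>?\<tau> \<omega> = T\<close>: lying outside \<open>A\<close>
      bounds the error by \<open>c\<close> on all of \<open>[0,T]\<close>, and lying in
      \<open>G\<close> gives \<open>T < \<sigma> \<omega>\<close>, so both alternatives of
      \<open>?B\<close> fail.\<close>
    have "?\<tau> \<omega> < T"
    proof (rule ccontr)
      assume "\<not> ?\<tau> \<omega> < T"
      with exit_time_le[OF T, of \<sigma> x Y R \<omega>] have \<tau>T: "?\<tau> \<omega> = T" by simp
      with small have "(SUP t\<in>{0..T}. ennreal (norm (x t \<omega> - Y t \<omega>))) \<le> ennreal c"
        by (intro SUP_least ennreal_leI) auto
      with \<omega> \<tau>T \<tau>\<sigma> show False by (auto simp: D_def)
    qed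
    \<comment> \<open>The error at the exit time is at most \<open>c < 1\<close>, which leaves only
      the alternative about the norm of \<open>x\<close>.\<close>
    from exit_time_early[where x = x and Y = Y, OF T x_cont[OF sp] Y_cont[OF sp] refl this \<tau>\<sigma>]
    have "R - 1 \<le> norm (x (?\<tau> \<omega>) \<omega>)"
      using small[of "?\<tau> \<omega>"] c(2) exit_time_nonneg[OF T, of \<sigma> x Y R \<omega>] by auto
    \<comment> \<open>\<open>1 \<le> R\<close> puts \<open>R - 1\<close> into the half-line on which
      \<open>\<phi>\<close> is monotone.\<close>
    then show "ennreal (\<phi> (R - 1)) \<le> ennreal (\<phi> (norm (x (?\<tau> \<omega>) \<omega>)))"
      using R by (intro ennreal_leI mono_onD[OF \<phi>(1)]) auto
  qed
  also note moment
  finally have "ennreal (\<phi> (R - 1)) * emeasure M D * ennreal (1 / \<phi> (R - 1)) \<le>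
      ennreal C * ennreal (1 / \<phi> (R - 1))"
    by (rule mult_right_mono) simp
  moreover have "ennreal (\<phi> (R - 1)) * emeasure M D * ennreal (1 / \<phi> (R - 1)) =
      (ennreal (\<phi> (R - 1)) * ennreal (1 / \<phi> (R - 1))) * emeasure M D"
    by (simp only: ac_simps)
  moreover have "ennreal (\<phi> (R - 1)) * ennreal (1 / \<phi> (R - 1)) = 1"
    using \<phi>(2) by (simp add: ennreal_mult[symmetric])
  ultimately have PD: "emeasure M D \<le> ennreal C * ennreal (1 / \<phi> (R - 1))" by simp
  \<comment> \<open>The covering holds only almost surely, through \<open>defined\<close>; no
    inclusion of sets is claimed.\<close>
  have "emeasure M ?B \<le> emeasure M (A \<union> D)"
  proof (rule emeasure_mono_AE)
    show "AE \<omega> in M. \<omega> \<in> ?B \<longrightarrow> \<omega> \<in> A \<union> D"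
      using defined by eventually_elim (auto simp: D_def G_def)
  qed measurable
  also have "\<dots> \<le> emeasure M A + emeasure M D"
    by (rule emeasure_subadditive) measurable
  also note add_mono[OF PA PD]
  finally show ?thesis .
qed

end

section \<open>The limit as \<open>h\<close> tends to 0\<close>

theorem theorem1:
  fixes T C :: real
    and M :: "'a measure" and F :: "real \<Rightarrow> 'a measure"
    and W :: "real \<Rightarrow> 'a \<Rightarrow> real^'m"
    and f :: "real^'p \<Rightarrow> real^'p" and g :: "real^'p \<Rightarrow> real^'m^'p"
    and fh :: "real \<Rightarrow> real^'p \<Rightarrow> real^'p" and gh :: "real \<Rightarrow> real^'p \<Rightarrow> real^'m^'p"
    and x0 :: "'a \<Rightarrow> real^'p" and \<sigma> :: "'a \<Rightarrow> real"
    and x :: "real \<Rightarrow> 'a \<Rightarrow> real^'p" and Y :: "real \<Rightarrow> real \<Rightarrow> 'a \<Rightarrow> real^'p"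
    and R \<gamma> \<phi> :: "real \<Rightarrow> real"
  assumes T: "T > 0"
    and space: "filtered_prob_space M F"
    and W: "brownian_motion M F W"
    and coeffs: "approx_coefficients f g fh gh"
    and x0: "x0 \<in> borel_measurable (F 0)"
    and x: "local_solution M F W T f g x0 \<sigma> x"
    and Y: "\<And>h. h \<in> {0<..<1} \<Longrightarrow> grid_approximation M F W T (fh h) (gh h) x0 h (Y h)"
    and R: "filterlim R at_top (at_right 0)"
    and \<gamma>_pos: "\<And>h. h \<in> {0<..<1} \<Longrightarrow> \<gamma> h > 0"
    and \<gamma>: "(\<gamma> \<longlongrightarrow> 0) (at_right 0)"
    and x_defined: "\<And>h. h \<in> {0<..<1} \<Longrightarrow> AE \<omega> in M. exit_time T \<sigma> x (Y h) (R h) \<omega> < \<sigma> \<omega>"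
    and rate: "((\<lambda>h. ennreal (1 / (\<gamma> h)\<^sup>2) *
                  (\<integral>\<^sup>+\<omega>. (SUP t\<in>{0..exit_time T \<sigma> x (Y h) (R h) \<omega>}.
                            ennreal ((norm (x t \<omega> - Y h t \<omega>))\<^sup>2)) \<partial>M)) \<longlongrightarrow> 0) (at_right 0)"
    and \<phi>_nonneg: "\<And>r. r \<ge> 0 \<Longrightarrow> \<phi> r \<ge> 0"
    and \<phi>_mono: "mono_on {0..} \<phi>"
    and \<phi>_growing: "filterlim \<phi> at_top at_top"
    and moment: "\<And>h. h \<in> {0<..<1} \<Longrightarrow>
                  (\<integral>\<^sup>+\<omega>. ennreal (\<phi> (norm (x (exit_time T \<sigma> x (Y h) (R h) \<omega>) \<omega>))) \<partial>M) \<le> ennreal C"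
  shows "((\<lambda>h. measure M {\<omega>\<in>space M. \<sigma> \<omega> \<le> T \<or>
                  (SUP t\<in>{0..T}. ennreal (norm (x t \<omega> - Y h t \<omega>))) > ennreal (\<gamma> h)})
          \<longlongrightarrow> 0) (at_right 0)"
proof -
  interpret prob_space M
    using space by (simp add: filtered_prob_space_def)
  have sub: "subalgebra M (F t)" for t
    using space by (simp add: filtered_prob_space_def)
  have \<sigma>_pos: "\<And>\<omega>. \<omega> \<in> space M \<Longrightarrow> 0 < \<sigma> \<omega>"
    and x_meas: "\<And>t. t \<in> {0..T} \<Longrightarrow> (\<lambda>\<omega>. if t < \<sigma> \<omega> then x t \<omega> else 0) \<in> borel_measurable M"
    and x_cont: "\<And>\<omega>. \<omega> \<in> space M \<Longrightarrow> continuous_on {t\<in>{0..T}. t < \<sigma> \<omega>} (\<lambda>t. x t \<omega>)"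
    and stop: "stopping_time F \<sigma>"
    using x unfolding local_solution_def by (auto intro: measurable_from_subalg[OF sub])
  have \<sigma>_meas: "\<sigma> \<in> borel_measurable M"
  proof (rule borel_measurable_iff_le[THEN iffD2], rule)
    fix t
    have "{\<omega>\<in>space (F t). \<sigma> \<omega> \<le> t} \<in> sets (F t)"
      using stop unfolding stopping_time_def pred_def by blast
    then show "{\<omega>\<in>space M. \<sigma> \<omega> \<le> t} \<in> sets M"
      using sub[of t] unfolding subalgebra_def by auto
  qed
  let ?B = "\<lambda>h. {\<omega>\<in>space M. \<sigma> \<omega> \<le> T \<or> (SUP t\<in>{0..T}. ennreal (norm (x t \<omega> - Y h t \<omega>))) > ennreal (\<gamma> h)}"
  let ?J = "\<lambda>h. ennreal (1 / (\<gamma> h)\<^sup>2) * (\<integral>\<^sup>+\<omega>. (SUP t\<in>{0..exit_time T \<sigma> x (Y h) (R h) \<omega>}.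
                            ennreal ((norm (x t \<omega> - Y h t \<omega>))\<^sup>2)) \<partial>M)"
  have small_h: "\<forall>\<^sub>F h in at_right 0. h \<in> {0<..<1::real}"
    by (rule eventually_at_right_real) simp
  have "filterlim (\<lambda>h. R h - 1) at_top (at_right 0)"
    using filterlim_tendsto_add_at_top[OF tendsto_const[of "-1"] R] by simp
  then have \<phi>R: "filterlim (\<lambda>h. \<phi> (R h - 1)) at_top (at_right 0)"
    by (rule filterlim_compose[OF \<phi>_growing])
  \<comment> \<open>The levels 1, 1 and 0 yield \<open>\<gamma> h < 1\<close>,
    \<open>1 \<le> R h\<close> and \<open>0 < \<phi> (R h - 1)\<close>, the side conditions of
    \<open>emeasure_error_le\<close>, for all small \<open>h\<close>.\<close>
  have "\<forall>\<^sub>F h in at_right 0. emeasure M (?B h) \<le> ?J h + ennreal C * ennreal (1 / \<phi> (R h - 1))"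
    using small_h order_tendstoD(2)[OF \<gamma> zero_less_one]
      R[unfolded filterlim_at_top, rule_format, of 1]
      \<phi>R[unfolded filterlim_at_top_dense, rule_format, of 0]
  proof eventually_elim
    case (elim h)
    from Y[OF elim(1)] have Yh: "\<And>t. t \<in> {0..T} \<Longrightarrow> Y h t \<in> borel_measurable (F t)"
      "\<And>\<omega>. \<omega> \<in> space M \<Longrightarrow> continuous_on {0..T} (\<lambda>t. Y h t \<omega>)"
      unfolding grid_approximation_def by simp_all
    show ?case
    proof (rule emeasure_error_le[where x = x and Y = "Y h" and \<sigma> = \<sigma> and M = M and T = T
          and R = "R h" and \<phi> = \<phi> and C = C and c = "\<gamma> h"])
      show "Y h t \<in> borel_measurable M" if "t \<in> {0..T}" for t
        by (rule measurable_from_subalg[OF sub Yh(1)[OF that]])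
    qed (fact T \<sigma>_meas x_meas x_cont Yh(2) \<sigma>_pos \<gamma>_pos[OF elim(1)] x_defined[OF elim(1)]
        moment[OF elim(1)] \<phi>_mono elim)+
  qed
  moreover have "((\<lambda>h. ?J h + ennreal C * ennreal (1 / \<phi> (R h - 1))) \<longlongrightarrow> 0) (at_right 0)"
  proof -
    have "((\<lambda>h. 1 / \<phi> (R h - 1)) \<longlongrightarrow> 0) (at_right 0)"
      using filterlim_at_top_imp_at_infinity[OF \<phi>R] by (intro tendsto_divide_0[OF tendsto_const])
    \<comment> \<open>\<open>ennreal C\<close> is finite, so multiplication by it preserves the
      limit 0.\<close>
    then have "((\<lambda>h. ennreal C * ennreal (1 / \<phi> (R h - 1))) \<longlongrightarrow> ennreal C * ennreal 0) (at_right 0)"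
      by (intro ennreal_tendsto_cmult tendsto_ennrealI) simp
    from tendsto_add[OF rate this] show ?thesis by simp
  qed
  ultimately have "((\<lambda>h. emeasure M (?B h)) \<longlongrightarrow> 0) (at_right 0)"
    by (rule tendsto_sandwich[OF always_eventually _ tendsto_const, rotated]) simp
  \<comment> \<open>Continuity of \<open>enn2real\<close> at the finite value 0 carries the limit
    from \<open>emeasure\<close> to \<open>measure\<close>.\<close>
  then show ?thesis
    using tendsto_enn2real[of "\<lambda>h. emeasure M (?B h)" 0] by (simp add: measure_def)
qed

end
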